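(* There holds (a) $\displaystyle\sum_{m\geq 1}\sum_{n\geq 0}\frac{q^{2m+n} (q^3;q^3)_{m-1} (q;q)_{m+n}(-q^3;q^3)_{m+n-1}}{(q;q)_{m-1} (q;q)_{m}^2(-q;q)_{m+n-1} (q^3;q^3)_{m+n}} =\frac{1}{3} \frac{(-q^3;q^3)_\infty}{(-q;q)_\infty(q;q)_\infty^2} +\frac{1}{6} \frac{(-q^3;q^3)_\infty (q;q)_\infty}{(q^3;q^3)_\infty (-q;q)_\infty}-\frac{1}{2}.$ (b) $\displaystyle\sum_{m\geq 1}\sum_{n\geq 0}\frac{q^{2m+n} (-q^3;q^3)_{m-1} (-q;q)_{m+n}(q^3;q^3)_{m+n-1}}{(-q;q)_{m-1} (q;q)_{m}^2 (q;q)_{m+n-1} (-q^3;q^3)_{m+n}} =\frac{1}{3} \frac{(q^3;q^3)_\infty}{(q;q)_\infty^3} -\frac{1}{2} \frac{(q^3;q^3)_\infty (-q;q)_\infty}{(-q^3;q^3)_\infty (q;q)_\infty}+\frac{1}{6}.$ (c) $\displaystyle\sum_{m\geq 1}\sum_{n\geq 0}\frac{q^{2m+n}(q^3;q^3)_{m-1} (q;q)_{m+n}(-q^3;q^3)_{m+n-1}}{(q;q)_{m-1} (-q;q)_{m}^2(-q;q)_{m+n-1} (q^3;q^3)_{m+n}} =\frac{1}{3} \frac{(-q^3;q^3)_\infty}{(-q;q)_\infty^3} -\frac{1}{2} \frac{(-q^3;q^3)_\infty (q;q)_\infty}{(q^3;q^3)_\infty (-q;q)_\infty}+\frac{1}{6}.$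 (d) $\displaystyle\sum_{m\geq 1}\sum_{n\geq 0}\frac{q^{2m+n}(-q^3;q^3)_{m-1} (-q;q)_{m+n}(q^3;q^3)_{m+n-1}}{(-q;q)_{m-1} (-q;q)_{m}^2 (q;q)_{m+n-1} (-q^3;q^3)_{m+n}} =\frac{1}{3} \frac{(q^3;q^3)_\infty}{(-q;q)_\infty(q^2;q^2)_\infty} +\frac{1}{6} \frac{(q^3;q^3)_\infty (-q;q)_\infty}{(-q^3;q^3)_\infty (q;q)_\infty}-\frac{1}{2}.$
   Context: Throughout $q$ is a complex number with $|q|<1$. Standard $q$-Pochhammer notation: $(a;q)_0=1$, $(a;q)_n=\prod_{j=0}^{n-1}(1-aq^j)$, $(a;q)_\infty=\prod_{j\geq 0}(1-aq^j)$, and $(a_1,\ldots,a_k;q)_n=\prod_{j}(a_j;q)_n$. *)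

theory Defs
  imports "HOL-Analysis.Analysis"
begin

definition qpoch :: "complex \<Rightarrow> complex \<Rightarrow> nat \<Rightarrow> complex" where
  "qpoch a q n = (\<Prod>j<n. 1 - a * q ^ j)"

(* The product converges for every a whenever norm q < 1. *)
definition qpoch_inf :: "complex \<Rightarrow> complex \<Rightarrow> complex" where
  "qpoch_inf a q = prodinf (\<lambda>j. 1 - a * q ^ j)"

end

theory Submission
  imports Defs
begin

text \<open>With \<open>P c n = (\<Prod>j=1..n. 1 - c q^j + q^(2j))\<close>, the quotients of \<open>q\<close>-shifted factorials in the
  summand are \<open>P c\<close> for \<open>c = -2, -1, 1, 2\<close>. Since numerator and denominator
  of \<open>P c n / P d n\<close> gain factors differing by \<open>(d - c) q^n\<close>, this quotient telescopes:
  \<open>P c n / P d n - P c (n-1) / P d (n-1) = (d - c) q^n P c (n-1) / P d n\<close>.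
  After the substitution \<open>N = m + n\<close> the inner sum over \<open>m\<close> telescopes, and then
  so do the two resulting sums over \<open>N\<close>.\<close>

section \<open>Quadratic products and their telescoping quotients\<close>

text \<open>If \<open>c = z + 1/z\<close>, each factor splits as
  \<open>(1 - z q^j) (1 - q^j / z)\<close>, so this is \<open>(zq, q/z; q)_n\<close> parametrised by
  the middle coefficient alone. Replacing \<open>c\<close> by another parameter then changes every
  factor linearly.\<close>

definition quad_prod :: "complex \<Rightarrow> complex \<Rightarrow> nat \<Rightarrow> complex" where
  "quad_prod q c n = (\<Prod>j<n. 1 - c * q ^ Suc j + (q ^ Suc j)\<^sup>2)"

lemma quad_prod_0 [simp]: "quad_prod q c 0 = 1"
  by (simp add: quad_prod_def)

lemma quad_prod_Suc:
  "quad_prod q c (Suc n) = quad_prod q c n * (1 - c * q ^ Suc n + (q ^ Suc n)\<^sup>2)"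
  by (simp add: quad_prod_def)

lemma quad_prod_telescope:
  assumes "\<And>n. quad_prod q d n \<noteq> 0" "c \<noteq> d"
  shows "q ^ Suc n * quad_prod q c n / quad_prod q d (Suc n)
       = quad_prod q c (Suc n) / quad_prod q d (Suc n) / (d - c)
         - quad_prod q c n / quad_prod q d n / (d - c)"
proof -
  define x where "x = q ^ Suc n"
  have nz: "quad_prod q d n \<noteq> 0" "1 - d * x + x\<^sup>2 \<noteq> 0" "d - c \<noteq> 0"
    using assms(1)[of n] assms(1)[of "Suc n"] assms(2) by (auto simp: quad_prod_Suc x_def)
  \<comment> \<open>Here \<open>u\<close> and \<open>v\<close> model the new factors for
    \<open>c\<close> and \<open>d\<close>, and \<open>w\<close> models \<open>d - c\<close>; the
    identity is just \<open>u - v = w * x\<close> over a common denominator.\<close>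
  have key: "x * A / (D * v) = A * u / (D * v) / w - A / D / w"
    if "D \<noteq> 0" "v \<noteq> 0" "w \<noteq> 0" "u = v + w * x" for A D u v w :: complex
    using that by (simp add: field_simps)
  have "1 - c * x + x\<^sup>2 = (1 - d * x + x\<^sup>2) + (d - c) * x"
    by (simp add: algebra_simps)
  from key[OF nz this, of "quad_prod q c n"] show ?thesis
    by (simp only: quad_prod_Suc x_def)
qed

section \<open>Absolute convergence of the double series\<close>

lemma nonzero_convergent_bounds:
  fixes f :: "nat \<Rightarrow> complex"
  assumes "f \<longlonglongrightarrow> l" "l \<noteq> 0" "\<And>n. f n \<noteq> 0"
  shows "\<exists>B>0. \<forall>n. norm (f n) \<le> B \<and> norm (inverse (f n)) \<le> B"
proof -
  \<comment> \<open>The limit is nonzero, so the reciprocals converge as well and both sequences are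
    bounded.\<close>
  have "Bseq f" "Bseq (\<lambda>n. inverse (f n))"
    using assms by (auto intro!: convergent_imp_Bseq convergentI tendsto_inverse)
  then obtain B1 B2 where "\<forall>n. norm (f n) \<le> B1" "\<forall>n. norm (inverse (f n)) \<le> B2" "B1 > 0"
    unfolding Bseq_def by blast
  then show ?thesis
    by (intro exI[of _ "max B1 B2"]) (auto simp: less_max_iff_disj intro: max.coboundedI1 max.coboundedI2)
qed

text \<open>The products and their reciprocals are uniformly bounded, so the terms are dominated by
  a constant times the double geometric series of \<open>norm q ^ (2 * m + n)\<close>. This is what
  licenses the later rearrangement.\<close>

lemma quad_prod_double_summable:
  fixes q c d e :: complex
  assumes q: "norm q < 1"
    and nz: "\<And>n. quad_prod q c n \<noteq> 0" "\<And>n. quad_prod q d n \<noteq> 0" "\<And>n. quad_prod q e n \<noteq> 0"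
    and lim: "quad_prod q c \<longlonglongrightarrow> C" "quad_prod q d \<longlonglongrightarrow> D" "quad_prod q e \<longlonglongrightarrow> E"
    and lim_nz: "C \<noteq> 0" "D \<noteq> 0" "E \<noteq> 0"
  shows "(\<lambda>(m, n). q ^ (2 * m + n) * quad_prod q c (m - 1) * quad_prod q d (m + n - 1)
            / (quad_prod q e m * quad_prod q c (m + n))) summable_on ({1..} \<times> UNIV)"
proof -
  obtain Bc where Bc: "\<And>n. norm (quad_prod q c n) \<le> Bc" "\<And>n. norm (inverse (quad_prod q c n)) \<le> Bc" "Bc > 0"
    using nonzero_convergent_bounds[OF lim(1) lim_nz(1) nz(1)] by blast
  obtain Bd where Bd: "\<And>n. norm (quad_prod q d n) \<le> Bd" "\<And>n. norm (inverse (quad_prod q d n)) \<le> Bd" "Bd > 0"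
    using nonzero_convergent_bounds[OF lim(2) lim_nz(2) nz(2)] by blast
  obtain Be where Be: "\<And>n. norm (quad_prod q e n) \<le> Be" "\<And>n. norm (inverse (quad_prod q e n)) \<le> Be" "Be > 0"
    using nonzero_convergent_bounds[OF lim(3) lim_nz(3) nz(3)] by blast
  have 1: "(\<lambda>m. norm q ^ (2 * m)) summable_on UNIV"
    using q summable_geometric[of "(norm q)\<^sup>2"]
    by (intro norm_summable_imp_summable_on) (simp add: power_mult power_less_one_iff)
  have 2: "(\<lambda>n. norm q ^ n) summable_on UNIV"
    using q summable_geometric[of "norm q"]
    by (intro norm_summable_imp_summable_on) (simp add: norm_power)
  have "(\<lambda>x. norm (case x of (m, n) \<Rightarrow> norm q ^ (2 * m) * norm q ^ n)) summable_on (UNIV \<times> UNIV)"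
    unfolding Infinite_Sum.abs_summable_on_Sigma_iff using 1 2
    by (auto simp: abs_mult infsum_cmult_right' intro!: summable_on_cmult_left summable_on_cmult_right)
  then have "(\<lambda>(m, n). norm q ^ (2 * m) * norm q ^ n) summable_on (UNIV \<times> UNIV)"
    by (rule abs_summable_summable)
  \<comment> \<open>One bound for each of the four products in a term; \<open>Bc\<close> occurs
    twice because \<open>c\<close> appears above and below the fraction bar.\<close>
  then have "(\<lambda>x. (Bc * Bd * (Be * Bc)) * (case x of (m, n) \<Rightarrow> norm q ^ (2 * m) * norm q ^ n))
      summable_on (UNIV \<times> UNIV)"
    by (rule summable_on_cmult_right)
  then have "(\<lambda>x. (Bc * Bd * (Be * Bc)) * (case x of (m, n) \<Rightarrow> norm q ^ (2 * m) * norm q ^ n))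
      summable_on ({1..} \<times> UNIV)"
    by (rule summable_on_subset_banach) auto
  then show ?thesis
  proof (rule summable_on_comparison_test[THEN abs_summable_summable], goal_cases)
    case (1 x)
    obtain m n where x: "x = (m, n)" by force
    have "norm (quad_prod q c (m - 1)) * norm (quad_prod q d (m + n - 1)) *
            (norm (inverse (quad_prod q e m)) * norm (inverse (quad_prod q c (m + n))))
          \<le> Bc * Bd * (Be * Bc)"
      using Bc Bd Be by (intro mult_mono) (auto intro: less_imp_le)
    then have "norm q ^ (2 * m + n) * (norm (quad_prod q c (m - 1)) * norm (quad_prod q d (m + n - 1)) *
            (norm (inverse (quad_prod q e m)) * norm (inverse (quad_prod q c (m + n)))))
          \<le> norm q ^ (2 * m + n) * (Bc * Bd * (Be * Bc))"
      by (intro mult_left_mono) auto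
    then show ?case
      by (simp add: x norm_mult norm_divide norm_power norm_inverse power_add divide_inverse mult_ac)
  qed auto
qed

section \<open>Evaluation of the double sum by telescoping\<close>

lemma quad_prod_double_sum:
  fixes q c d e :: complex
  assumes q: "norm q < 1"
    and nz: "\<And>n. quad_prod q c n \<noteq> 0" "\<And>n. quad_prod q d n \<noteq> 0" "\<And>n. quad_prod q e n \<noteq> 0"
    and lim: "quad_prod q c \<longlonglongrightarrow> C" "quad_prod q d \<longlonglongrightarrow> D" "quad_prod q e \<longlonglongrightarrow> E"
    and lim_nz: "C \<noteq> 0" "D \<noteq> 0" "E \<noteq> 0"
    and ne: "c \<noteq> e" "d \<noteq> e" "d \<noteq> c"
  shows "((\<lambda>(m, n). q ^ (2 * m + n) * quad_prod q c (m - 1) * quad_prod q d (m + n - 1)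
            / (quad_prod q e m * quad_prod q c (m + n)))
          has_sum (((D / E - 1) / (e - d) - (D / C - 1) / (c - d)) / (e - c))) ({1..} \<times> UNIV)"
    (is "(?f has_sum ?L) _")
proof -
  define P where "P = quad_prod q"
  \<comment> \<open>\<open>K\<close> is the discrete antiderivative in \<open>N\<close> of the inner
    sums.\<close>
  define K where "K n = (P d n / P e n / (e - d) - P d n / P c n / (c - d)) / (e - c)" for n
  \<comment> \<open>Both indices start at 0: \<open>N\<close> stands for \<open>m + n - 1\<close>
    and \<open>k\<close> for \<open>m - 1\<close>, so the region becomes \<open>k \<le> N\<close>.
    The term separates into a factor in \<open>N\<close> and a factor in \<open>k\<close>.\<close>
  define h where "h N k = q ^ Suc N * P d N / P c (Suc N) * (q ^ Suc k * P c k / P e (Suc k))" for N k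
  obtain S where S: "(?f has_sum S) ({1..} \<times> UNIV)"
    using quad_prod_double_summable[OF assms(1-10)] by (auto simp: summable_on_def)
  have "((\<lambda>(N, k). h N k) has_sum S) (Sigma UNIV (\<lambda>N. {..N})) \<longleftrightarrow> (?f has_sum S) ({1..} \<times> UNIV)"
  proof (rule has_sum_reindex_bij_witness[where j = "\<lambda>(N, k). (Suc k, N - k)"
        and i = "\<lambda>(m, n). (m + n - 1, m - 1)"], goal_cases)
    case (5 x)
    then obtain N k where x: "x = (N, k)" "k \<le> N" by auto
    then have *: "2 * Suc k + (N - k) = Suc N + Suc k" "Suc k + (N - k) = Suc N" by auto
    have "q ^ (2 * Suc k + (N - k)) = q ^ Suc N * q ^ Suc k"
      by (simp only: * power_add)
    then show ?case
      by (simp only: x h_def P_def prod.case * diff_Suc_1) (simp add: mult_ac)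
  qed auto
  with S have "((\<lambda>(N, k). h N k) has_sum S) (Sigma UNIV (\<lambda>N. {..N}))" by simp
  then have "((\<lambda>N. \<Sum>k\<le>N. h N k) has_sum S) UNIV"
    by (rule has_sum_SigmaD) (simp add: has_sum_finite)
  then have 1: "(\<lambda>N. \<Sum>k\<le>N. h N k) sums S"
    by (rule has_sum_imp_sums)
  have 2: "(\<Sum>k\<le>N. h N k) = K (Suc N) - K N" for N
  proof -
    have "(\<Sum>k\<le>N. q ^ Suc k * P c k / P e (Suc k))
        = (\<Sum>k<Suc N. P c (Suc k) / P e (Suc k) / (e - c) - P c k / P e k / (e - c))"
      using nz ne by (simp only: P_def lessThan_Suc_atMost quad_prod_telescope not_False_eq_True)
    also have "\<dots> = (P c (Suc N) / P e (Suc N) - 1) / (e - c)"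
      by (subst sum_lessThan_telescope) (simp add: P_def diff_divide_distrib)
    finally have "(\<Sum>k\<le>N. h N k) = q ^ Suc N * P d N / P c (Suc N) *
        ((P c (Suc N) / P e (Suc N) - 1) / (e - c))"
      by (simp only: h_def sum_distrib_left [symmetric])
    \<comment> \<open>The factor \<open>P c (Suc N)\<close> cancels in the first term, leaving two
      terms of telescoping shape, with denominators for \<open>e\<close> and for
      \<open>c\<close>.\<close>
    also have "\<dots> = (q ^ Suc N * P d N / P e (Suc N) - q ^ Suc N * P d N / P c (Suc N)) / (e - c)"
      using nz(1)[of "Suc N"] nz(3)[of "Suc N"] ne by (simp add: P_def divide_simps) (simp add: algebra_simps)
    also have "\<dots> = K (Suc N) - K N"
      using nz ne unfolding P_def K_def
      by (subst (1 2) quad_prod_telescope) (auto simp: diff_divide_distrib)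
    finally show ?thesis .
  qed
  have "K \<longlonglongrightarrow> (D / E / (e - d) - D / C / (c - d)) / (e - c)"
    unfolding K_def P_def using ne lim lim_nz by (intro tendsto_intros) auto
  then have "(\<lambda>N. K (Suc N) - K N) sums ((D / E / (e - d) - D / C / (c - d)) / (e - c) - K 0)"
    by (rule telescope_sums)
  with 1 have "S = (D / E / (e - d) - D / C / (c - d)) / (e - c) - K 0"
    by (simp add: 2 sums_unique2)
  \<comment> \<open>All products are 1 at index 0, so \<open>K 0\<close> supplies the two
    \<open>-1\<close> terms of the closed form.\<close>
  also have "\<dots> = ?L"
    by (simp add: K_def P_def diff_divide_distrib)
  finally show ?thesis using S by simp
qed

section \<open>Nonvanishing and convergence of \<open>q\<close>-shifted factorials\<close>

lemma one_minus_nonzero: "norm (x :: complex) < 1 \<Longrightarrow> 1 - x \<noteq> 0"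
  by auto

lemma norm_mult_power_less_1:
  fixes a q :: complex
  assumes "norm a < 1" "norm q < 1"
  shows "norm (a * q ^ n) < 1"
proof -
  have "norm a * norm q ^ n \<le> norm a * 1"
    using assms by (intro mult_left_mono power_le_one) auto
  with assms show ?thesis by (simp add: norm_mult norm_power)
qed

lemma qpoch_nonzero:
  assumes "norm a < 1" "norm q < 1"
  shows "qpoch a q n \<noteq> 0"
  unfolding qpoch_def prod_zero_iff[OF finite_lessThan]
  using one_minus_nonzero[OF norm_mult_power_less_1[OF assms]] by blast

lemma qpoch_convergent_prod:
  fixes a q :: complex
  assumes "norm q < 1"
  shows "convergent_prod (\<lambda>j. 1 - a * q ^ j)"
proof -
  have "summable (\<lambda>j. norm (1 - a * q ^ j - 1))"
    using summable_mult[OF summable_geometric[of "norm q"], of "norm a"] assms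
    by (simp add: norm_mult norm_power)
  then show ?thesis
    by (intro abs_convergent_prod_imp_convergent_prod summable_imp_abs_convergent_prod)
qed

lemma qpoch_inf_nonzero:
  assumes "norm a < 1" "norm q < 1"
  shows "qpoch_inf a q \<noteq> 0"
  unfolding qpoch_inf_def
  using norm_mult_power_less_1[OF assms] assms
  by (intro prodinf_nonzero qpoch_convergent_prod one_minus_nonzero) auto

lemma qpoch_tendsto:
  assumes "norm q < 1"
  shows "qpoch a q \<longlonglongrightarrow> qpoch_inf a q"
proof -
  have "(\<lambda>n. \<Prod>j\<le>n. 1 - a * q ^ j) \<longlonglongrightarrow> qpoch_inf a q"
    unfolding qpoch_inf_def by (intro convergent_prod_LIMSEQ qpoch_convergent_prod assms)
  then show ?thesis
    by (subst filterlim_sequentially_Suc [symmetric]) (simp add: qpoch_def lessThan_Suc_atMost)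
qed

lemma qpoch_square: "qpoch q q n * qpoch (-q) q n = qpoch (q\<^sup>2) (q\<^sup>2) n"
  unfolding qpoch_def prod.distrib [symmetric]
  by (intro prod.cong) (auto simp: power2_eq_square power_mult_distrib algebra_simps)

lemma qpoch_inf_square:
  assumes "norm q < 1"
  shows "qpoch_inf q q * qpoch_inf (-q) q = qpoch_inf (q\<^sup>2) (q\<^sup>2)"
proof -
  have "norm (q\<^sup>2) < 1"
    using assms by (simp add: norm_power power_less_one_iff)
  moreover have "qpoch (q\<^sup>2) (q\<^sup>2) \<longlonglongrightarrow> qpoch_inf q q * qpoch_inf (-q) q"
    unfolding qpoch_square [symmetric] using assms by (intro tendsto_mult qpoch_tendsto)
  ultimately show ?thesis
    using LIMSEQ_unique qpoch_tendsto by blast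
qed

section \<open>Quadratic products as quotients of \<open>q\<close>-shifted factorials\<close>

lemma quad_prod_2: "quad_prod q 2 n = qpoch q q n ^ 2"
  unfolding quad_prod_def qpoch_def prod_power_distrib
  by (intro prod.cong) (auto simp: power2_eq_square algebra_simps)

lemma quad_prod_minus_2: "quad_prod q (-2) n = qpoch (-q) q n ^ 2"
  unfolding quad_prod_def qpoch_def prod_power_distrib
  by (intro prod.cong) (auto simp: power2_eq_square algebra_simps)

text \<open>Factorwise this is \<open>(1 + x + x^2) (1 - x) = 1 - x^3\<close> with
  \<open>x = q^j\<close>.\<close>

lemma quad_prod_minus_1:
  assumes "norm q < 1"
  shows "quad_prod q (-1) n = qpoch (q^3) (q^3) n / qpoch q q n"
proof -
  have "quad_prod q (-1) n * qpoch q q n = qpoch (q^3) (q^3) n"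
    unfolding quad_prod_def qpoch_def prod.distrib [symmetric]
    by (intro prod.cong)
       (auto simp: power2_eq_square power3_eq_cube power_mult_distrib algebra_simps)
  then show ?thesis
    using qpoch_nonzero[OF assms assms] by (simp add: field_simps)
qed

text \<open>The sign-changed analogue: \<open>(1 - x + x^2) (1 + x) = 1 + x^3\<close>.\<close>

lemma quad_prod_1:
  assumes "norm q < 1"
  shows "quad_prod q 1 n = qpoch (-(q^3)) (q^3) n / qpoch (-q) q n"
proof -
  have "quad_prod q 1 n * qpoch (-q) q n = qpoch (-(q^3)) (q^3) n"
    unfolding quad_prod_def qpoch_def prod.distrib [symmetric]
    by (intro prod.cong)
       (auto simp: power2_eq_square power3_eq_cube power_mult_distrib algebra_simps)
  then show ?thesis
    using qpoch_nonzero[of "-q" q] assms by (simp add: field_simps)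
qed

section \<open>The four double sums as special parameter choices\<close>

theorem theorem2p3:
  fixes q :: complex
  assumes "norm q < 1"
  shows
    "((\<lambda>(m, n). q ^ (2 * m + n) * qpoch (q^3) (q^3) (m - 1) * qpoch q q (m + n) * qpoch (-(q^3)) (q^3) (m + n - 1)
           / (qpoch q q (m - 1) * qpoch q q m ^ 2 * qpoch (-q) q (m + n - 1) * qpoch (q^3) (q^3) (m + n)))
       has_sum
         (1/3 * (qpoch_inf (-(q^3)) (q^3) / (qpoch_inf (-q) q * qpoch_inf q q ^ 2))
          + 1/6 * ((qpoch_inf (-(q^3)) (q^3) * qpoch_inf q q) / (qpoch_inf (q^3) (q^3) * qpoch_inf (-q) q))
          - 1/2))
       ({1..} \<times> UNIV)
     \<and>
     ((\<lambda>(m, n). q ^ (2 * m + n) * qpoch (-(q^3)) (q^3) (m - 1) * qpoch (-q) q (m + n) * qpoch (q^3) (q^3) (m + n - 1)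
           / (qpoch (-q) q (m - 1) * qpoch q q m ^ 2 * qpoch q q (m + n - 1) * qpoch (-(q^3)) (q^3) (m + n)))
       has_sum
         (1/3 * (qpoch_inf (q^3) (q^3) / qpoch_inf q q ^ 3)
          - 1/2 * ((qpoch_inf (q^3) (q^3) * qpoch_inf (-q) q) / (qpoch_inf (-(q^3)) (q^3) * qpoch_inf q q))
          + 1/6))
       ({1..} \<times> UNIV)
     \<and>
     ((\<lambda>(m, n). q ^ (2 * m + n) * qpoch (q^3) (q^3) (m - 1) * qpoch q q (m + n) * qpoch (-(q^3)) (q^3) (m + n - 1)
           / (qpoch q q (m - 1) * qpoch (-q) q m ^ 2 * qpoch (-q) q (m + n - 1) * qpoch (q^3) (q^3) (m + n)))
       has_sum
         (1/3 * (qpoch_inf (-(q^3)) (q^3) / qpoch_inf (-q) q ^ 3)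
          - 1/2 * ((qpoch_inf (-(q^3)) (q^3) * qpoch_inf q q) / (qpoch_inf (q^3) (q^3) * qpoch_inf (-q) q))
          + 1/6))
       ({1..} \<times> UNIV)
     \<and>
     ((\<lambda>(m, n). q ^ (2 * m + n) * qpoch (-(q^3)) (q^3) (m - 1) * qpoch (-q) q (m + n) * qpoch (q^3) (q^3) (m + n - 1)
           / (qpoch (-q) q (m - 1) * qpoch (-q) q m ^ 2 * qpoch q q (m + n - 1) * qpoch (-(q^3)) (q^3) (m + n)))
       has_sum
         (1/3 * (qpoch_inf (q^3) (q^3) / (qpoch_inf (-q) q * qpoch_inf (q^2) (q^2)))
          + 1/6 * ((qpoch_inf (q^3) (q^3) * qpoch_inf (-q) q) / (qpoch_inf (-(q^3)) (q^3) * qpoch_inf q q))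
          - 1/2))
       ({1..} \<times> UNIV)"
proof -
  have q3: "norm (q^3) < 1" "norm (-(q^3)) < 1" and q1: "norm (-q) < 1"
    using assms by (auto simp: norm_power power_less_one_iff)
  note nz = qpoch_nonzero[OF assms assms] qpoch_nonzero[OF q1 assms]
    qpoch_nonzero[OF q3(1) q3(1)] qpoch_nonzero[OF q3(2) q3(1)]
  note inf_nz = qpoch_inf_nonzero[OF assms assms] qpoch_inf_nonzero[OF q1 assms]
    qpoch_inf_nonzero[OF q3(1) q3(1)] qpoch_inf_nonzero[OF q3(2) q3(1)]
  note qp = quad_prod_1[OF assms] quad_prod_minus_1[OF assms] quad_prod_2 quad_prod_minus_2
  define A B C D where "A = qpoch_inf q q" and "B = qpoch_inf (-q) q"
    and "C = qpoch_inf (q^3) (q^3)" and "D = qpoch_inf (-(q^3)) (q^3)"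
  have ABCD: "A \<noteq> 0" "B \<noteq> 0" "C \<noteq> 0" "D \<noteq> 0"
    using inf_nz by (simp_all add: A_def B_def C_def D_def)
  have lims: "quad_prod q 1 \<longlonglongrightarrow> D / B" "quad_prod q (-1) \<longlonglongrightarrow> C / A"
      "quad_prod q 2 \<longlonglongrightarrow> A\<^sup>2" "quad_prod q (-2) \<longlonglongrightarrow> B\<^sup>2"
    unfolding qp A_def B_def C_def D_def
    using assms q3 inf_nz by (auto intro!: tendsto_intros qpoch_tendsto)
  have qp_nz: "quad_prod q 1 n \<noteq> 0" "quad_prod q (-1) n \<noteq> 0"
      "quad_prod q 2 n \<noteq> 0" "quad_prod q (-2) n \<noteq> 0" for n
    using nz by (auto simp: qp)
  have lim_nz: "D / B \<noteq> 0" "C / A \<noteq> 0" "A\<^sup>2 \<noteq> 0" "B\<^sup>2 \<noteq> 0"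
    using ABCD by auto
  note fold_limits = A_def [symmetric] B_def [symmetric] C_def [symmetric] D_def [symmetric]
  have sq: "qpoch_inf (q\<^sup>2) (q\<^sup>2) = A * B"
    using qpoch_inf_square[OF assms] by (simp add: A_def B_def)
  \<comment> \<open>Transfers a has-sum statement to a summand and a value written with
    \<open>q\<close>-shifted factorials, leaving two algebraic identities to check.\<close>
  have double_sum: "(f has_sum s) ({1..} \<times> UNIV)"
    if "((\<lambda>(m, n). q ^ (2 * m + n) * quad_prod q c (m - 1) * quad_prod q d (m + n - 1)
            / (quad_prod q e m * quad_prod q c (m + n))) has_sum t) ({1..} \<times> UNIV)"
      and "\<And>m n. f (m, n) = q ^ (2 * m + n) * quad_prod q c (m - 1) * quad_prod q d (m + n - 1)
            / (quad_prod q e m * quad_prod q c (m + n))"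
      and "s = t" for f s t c d e
  proof -
    have "f = (\<lambda>(m, n). q ^ (2 * m + n) * quad_prod q c (m - 1) * quad_prod q d (m + n - 1)
            / (quad_prod q e m * quad_prod q c (m + n)))"
      using that(2) by auto
    with that(1,3) show ?thesis by simp
  qed
  show ?thesis
  proof (intro conjI, goal_cases)
    \<comment> \<open>The four cases use \<open>(c, d, e) = (-1, 1, 2)\<close>,
      \<open>(1, -1, 2)\<close>, \<open>(-1, 1, -2)\<close> and \<open>(1, -1, -2)\<close>. Here the
      differences \<open>e - d = 1\<close>, \<open>c - d = -2\<close>, \<open>e - c = 3\<close> give
      the coefficients 1/3 and 1/6 and the constant \<open>-1/3 - 1/6 = -1/2\<close>.\<close>
    case 1
    show ?case
      unfolding fold_limits sq
      by (rule double_sum[OF quad_prod_double_sum[OF assms qp_nz(2) qp_nz(1) qp_nz(3)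
            lims(2) lims(1) lims(3) lim_nz(2) lim_nz(1) lim_nz(3)]])
         (use ABCD in \<open>simp_all add: qp power2_eq_square power3_eq_cube
            add_divide_distrib diff_divide_distrib mult_ac\<close>)
  next
    case 2
    show ?case
      unfolding fold_limits sq
      by (rule double_sum[OF quad_prod_double_sum[OF assms qp_nz(1) qp_nz(2) qp_nz(3)
            lims(1) lims(2) lims(3) lim_nz(1) lim_nz(2) lim_nz(3)]])
         (use ABCD in \<open>simp_all add: qp power2_eq_square power3_eq_cube
            add_divide_distrib diff_divide_distrib mult_ac\<close>)
  next
    case 3
    show ?case
      unfolding fold_limits sq
      by (rule double_sum[OF quad_prod_double_sum[OF assms qp_nz(2) qp_nz(1) qp_nz(4)
            lims(2) lims(1) lims(4) lim_nz(2) lim_nz(1) lim_nz(4)]])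
         (use ABCD in \<open>simp_all add: qp power2_eq_square power3_eq_cube
            add_divide_distrib diff_divide_distrib mult_ac\<close>)
  next
    \<comment> \<open>The first limit quotient is \<open>C / (A * B^2)\<close>; it matches the
      stated denominator because \<open>(q^2; q^2)\<close> at infinity is
      \<open>A * B\<close>.\<close>
    case 4
    show ?case
      unfolding fold_limits sq
      by (rule double_sum[OF quad_prod_double_sum[OF assms qp_nz(1) qp_nz(2) qp_nz(4)
            lims(1) lims(2) lims(4) lim_nz(1) lim_nz(2) lim_nz(4)]])
         (use ABCD in \<open>simp_all add: qp power2_eq_square power3_eq_cube
            add_divide_distrib diff_divide_distrib mult_ac\<close>)
  qed
qed

end
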